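(* Let $z_1,z_2,\ldots,z_N$ be not necessarily distinct numbers from the open unit disk. Then there exists an $N\times N$ truncated CMV matrix $\mathcal{T}$ which has eigenvalues $z_1,z_2,\ldots,z_N$, counting their algebraic multiplicities. Such a matrix is determined uniquely up to multiplication of its parameters $\alpha_0(\mathcal{T}),\dots,\alpha_N(\mathcal{T})$ by the same unimodular factor.
   Context: $\mathbb{D}$ is the open unit disk. An $N\times N$ truncated CMV matrix is determined by numbers $\alpha_0,\dots,\alpha_{N-1}\in\mathbb{D}$ and $|\alpha_N|=1$; with $\rho_n=\sqrt{1-|\alpha_n|^2}$, $\mathcal{T}=\mathcal{T}(\{\alpha_n\}_{n=0}^N)=(t_{ij})_{i,j=1}^N$ has entries $t_{m,m}=-\bar\alpha_m\alpha_{m-1}$; for $m$ odd: $t_{m+1,m}=\bar\alpha_{m+1}\rho_m$, $t_{m,m+1}=-\alpha_{m-1}\rho_m$, $t_{m+2,m}=\rho_m\rho_{m+1}$, $t_{m,m+2}=0$; for $m$ even: $t_{m+1,m}=-\alpha_{m-1}\rho_m$, $t_{m,m+1}=\bar\alpha_{m+1}\rho_m$, $t_{m+2,m}=0$, $t_{m,m+2}=\rho_m\rho_{m+1}$ (whenever the indices are $\le N$); all other entries are $0$. The numbers $\alpha_n=\alpha_n(\mathcal{T})$, $n=0,\dots,N$, are called the parameters of $\mathcal{T}$. *)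

theory Defs
  imports Complex_Main "HOL-Computational_Algebra.Computational_Algebra"
    "Jordan_Normal_Form.Char_Poly"
begin

text \<open>Parameter sequences are functions of which only the values at \<open>0, \<dots>, N\<close> matter.\<close>

definition cmv_parameters :: "nat \<Rightarrow> (nat \<Rightarrow> complex) \<Rightarrow> bool" where
  "cmv_parameters N \<alpha> \<longleftrightarrow> (\<forall>n<N. cmod (\<alpha> n) < 1) \<and> cmod (\<alpha> N) = 1"

definition cmv_rho :: "(nat \<Rightarrow> complex) \<Rightarrow> nat \<Rightarrow> complex" where
  "cmv_rho \<alpha> n = complex_of_real (sqrt (1 - (cmod (\<alpha> n))\<^sup>2))"

text \<open>Row and column indices start at 1 here.\<close>

definition cmv_entry :: "(nat \<Rightarrow> complex) \<Rightarrow> nat \<Rightarrow> nat \<Rightarrow> complex" where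
  "cmv_entry \<alpha> i j =
    (if i = j then - cnj (\<alpha> i) * \<alpha> (i - 1)
     else if i = j + 1 then
       (if odd j then cnj (\<alpha> (j + 1)) * cmv_rho \<alpha> j else - \<alpha> (j - 1) * cmv_rho \<alpha> j)
     else if j = i + 1 then
       (if odd i then - \<alpha> (i - 1) * cmv_rho \<alpha> i else cnj (\<alpha> (i + 1)) * cmv_rho \<alpha> i)
     else if i = j + 2 then
       (if odd j then cmv_rho \<alpha> j * cmv_rho \<alpha> (j + 1) else 0)
     else if j = i + 2 then
       (if odd i then 0 else cmv_rho \<alpha> i * cmv_rho \<alpha> (i + 1))
     else 0)"

text \<open>Library matrices are indexed from 0, hence the shift.\<close>

definition truncated_cmv :: "nat \<Rightarrow> (nat \<Rightarrow> complex) \<Rightarrow> complex mat" where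
  "truncated_cmv N \<alpha> = mat N N (\<lambda>(i, j). cmv_entry \<alpha> (i + 1) (j + 1))"

text \<open>The multiset of eigenvalues, each repeated according to its algebraic multiplicity,
  that is, its multiplicity as a root of the characteristic polynomial.\<close>

definition eigenvalue_mset :: "complex mat \<Rightarrow> complex multiset" where
  "eigenvalue_mset A = proots (char_poly A)"

end

theory Submission
  imports Defs
begin

text \<open>
  The matrix \<open>T\<close> factors as \<open>L M\<close>, where \<open>L\<close> and \<open>M\<close> are block diagonal with the staggered
  blocks \<open>\<Theta>\<^sub>k\<close> that have rows \<open>(cnj \<alpha>\<^sub>k, \<rho>\<^sub>k)\<close> and \<open>(\<rho>\<^sub>k, - \<alpha>\<^sub>k)\<close>: \<open>k\<close> is odd in \<open>M\<close> and even in \<open>L\<close>.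
  Since \<open>M\<close> is unitary, \<open>x - T = (x M\<^sup>* - L) M\<close>, and staggering makes \<open>x M\<^sup>* - L\<close> tridiagonal.
  The three-term recursion for the trailing minors of this matrix is, up to constants, the Szego
  recursion \<open>\<Phi>\<^sub>n\<^sub>+\<^sub>1 = x \<Phi>\<^sub>n + b\<^sub>n \<Phi>\<^sub>n\<^sup>*\<close>, in which the parameters enter from the bottom of the
  matrix to the top: \<open>b\<^sub>n = \<alpha>\<^sub>N\<^sub>-\<^sub>1\<^sub>-\<^sub>n cnj \<alpha>\<^sub>N\<close>. Hence the characteristic polynomial of \<open>T\<close> is
  \<open>\<Phi>\<^sub>N\<close> (lemma \<open>char_poly_truncated_cmv\<close>).

  It remains to see that \<open>b \<mapsto> \<Phi>\<^sub>N\<close> is a bijection from sequences in the unit disk onto the monic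
  polynomials of degree \<open>N\<close> whose roots lie in the disk, which is the Schur-Cohn algorithm.
  As \<open>b\<^sub>n = \<Phi>\<^sub>n\<^sub>+\<^sub>1(0)\<close>, a step of the recursion can be undone:
  \<open>(1 - |b\<^sub>n|\<^sup>2) x \<Phi>\<^sub>n = \<Phi>\<^sub>n\<^sub>+\<^sub>1 - b\<^sub>n \<Phi>\<^sub>n\<^sub>+\<^sub>1\<^sup>*\<close>. This gives injectivity (\<open>szego_inject\<close>). For
  surjectivity (\<open>szego_surj\<close>) this formula is used to define \<open>\<Phi>\<^sub>n\<close>; its roots stay in the disk
  because \<open>|P\<^sup>*| \<le> |P|\<close> outside the disk for a polynomial \<open>P\<close> with all roots inside.

  Finally, the products \<open>\<alpha>\<^sub>n cnj \<alpha>\<^sub>N\<close> with \<open>n < N\<close>, and \<open>|\<alpha>\<^sub>N| = 1\<close>, determine the parameters exactly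
  up to a common unimodular factor.
\<close>

section \<open>Conjugate reversal of polynomials\<close>

text \<open>This is the operation \<open>P \<mapsto> P\<^sup>*\<close>, with \<open>P\<^sup>*(w) = w\<^sup>n cnj (P (1 / cnj w))\<close> for \<open>n = degree P\<close>.\<close>

definition conj_reflect :: "complex poly \<Rightarrow> complex poly" where
  "conj_reflect p = map_poly cnj (reflect_poly p)"

lemma coeff_conj_reflect:
  "coeff (conj_reflect p) k = (if k \<le> degree p then cnj (coeff p (degree p - k)) else 0)"
  by (simp add: conj_reflect_def coeff_map_poly coeff_reflect_poly)

lemma conj_reflect_pCons_0 [simp]: "conj_reflect (pCons 0 p) = conj_reflect p"
proof (cases "p = 0")
  case False
  have "k \<le> Suc (degree p) \<Longrightarrow> \<not> k \<le> degree p \<Longrightarrow> k = Suc (degree p)" for k by simp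
  then show ?thesis
    using False by (intro poly_eqI) (auto simp: coeff_conj_reflect Suc_diff_le not_le)
qed simp

lemma conj_reflect_smult: "conj_reflect (Polynomial.smult c p) = Polynomial.smult (cnj c) (conj_reflect p)"
  by (cases "c = 0") (auto intro!: poly_eqI simp: coeff_conj_reflect)

text \<open>The operation is conjugate linear and involutive on polynomials of a fixed formal degree.
  The assumption on degrees ensures that formal and actual degree coincide. Both the Szego
  recursion and its inverse consist of such a linear combination.\<close>

lemma conj_reflect_add_smult:
  assumes "degree (p + Polynomial.smult c (conj_reflect p)) = degree p"
  shows "conj_reflect (p + Polynomial.smult c (conj_reflect p)) = conj_reflect p + Polynomial.smult (cnj c) p"
  by (rule poly_eqI) (auto simp: assms coeff_conj_reflect coeff_eq_0)

lemma poly_conj_reflect: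
  assumes "w \<noteq> 0"
  shows "poly (conj_reflect p) w = w ^ degree p * cnj (poly p (inverse (cnj w)))"
proof -
  have "poly (conj_reflect p) w = cnj (poly (reflect_poly p) (cnj w))"
    unfolding conj_reflect_def by (metis complex_cnj_cnj poly_cnj)
  then show ?thesis using assms by (simp add: poly_reflect_poly_nz)
qed

text \<open>Up to constants, \<open>P\<close> is a product of factors \<open>w - r\<close> with \<open>|r| < 1\<close>, and \<open>P\<^sup>*\<close> is the product of the
  factors \<open>1 - cnj r w\<close>. Each quotient is a Blaschke factor, of modulus at least \<open>1\<close> off the disk.\<close>

lemma norm_conj_reflect_le:
  fixes p :: "complex poly"
  assumes roots: "\<And>w. poly p w = 0 \<Longrightarrow> cmod w < 1" and w: "cmod w \<ge> 1"
  shows "cmod (poly (conj_reflect p) w) \<le> cmod (poly p w)"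
proof -
  have "p \<noteq> 0" using roots[of 1] by auto
  then obtain A where A: "size A = degree p" "p = Polynomial.smult (lead_coeff p) (\<Prod>x\<in>#A. [:-x, 1:])"
    using alg_closed_imp_factorization by blast
  have poly_p: "poly p v = lead_coeff p * (\<Prod>x\<in>#A. v - x)" for v
    by (subst A(2)) (simp add: poly_prod_mset)
  have "cmod x < 1" if "x \<in># A" for x
    by (rule roots) (use that in \<open>auto simp: poly_p\<close>)
  then have "cmod w ^ size A * cmod (\<Prod>x\<in>#A. inverse (cnj w) - x) \<le> cmod (\<Prod>x\<in>#A. w - x)"
  proof (induction A)
    case (add x A)
    have w0: "w \<noteq> 0" using w by auto
    have "cmod w * cmod (inverse (cnj w) - x) = cmod (cnj w * (inverse (cnj w) - x))"
      by (simp add: norm_mult)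
    also have "cnj w * (inverse (cnj w) - x) = 1 - cnj w * x"
      using w0 by (simp add: algebra_simps)
    also have "cmod (1 - cnj w * x) \<le> cmod (w - x)"
    proof -
      have "(cmod (w - x))\<^sup>2 - (cmod (1 - cnj w * x))\<^sup>2 = ((cmod w)\<^sup>2 - 1) * (1 - (cmod x)\<^sup>2)"
        by (simp add: cmod_power2) (simp add: power2_eq_square algebra_simps)
      moreover have "\<dots> \<ge> 0"
        using w add.prems[of x] by (intro mult_nonneg_nonneg) (auto simp: abs_square_le_1)
      ultimately have "(cmod (1 - cnj w * x))\<^sup>2 \<le> (cmod (w - x))\<^sup>2" by linarith
      then show ?thesis by (rule power2_le_imp_le) simp
    qed
    finally have "cmod w * cmod (inverse (cnj w) - x) \<le> cmod (w - x)" .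
    from mult_mono[OF this add.IH] add.prems show ?case
      by (simp add: norm_mult mult_ac)
  qed simp
  then have "cmod (lead_coeff p) * (cmod w ^ size A * cmod (\<Prod>x\<in>#A. inverse (cnj w) - x))
      \<le> cmod (lead_coeff p) * cmod (\<Prod>x\<in>#A. w - x)"
    by (rule mult_left_mono) simp
  moreover have "w \<noteq> 0" using w by auto
  ultimately show ?thesis
    by (simp add: poly_conj_reflect poly_p norm_mult norm_power A(1) mult_ac)
qed

text \<open>Up to sign, the constant coefficient is the product of the roots.\<close>

lemma norm_coeff_0_less_1:
  fixes p :: "complex poly"
  assumes roots: "\<And>w. poly p w = 0 \<Longrightarrow> cmod w < 1" and "lead_coeff p = 1" "degree p > 0"
  shows "cmod (coeff p 0) < 1"
proof -
  obtain A where A: "size A = degree p" "p = Polynomial.smult (lead_coeff p) (\<Prod>x\<in>#A. [:-x, 1:])"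
    using alg_closed_imp_factorization[of p] assms(3) by force
  have poly_p: "poly p v = (\<Prod>x\<in>#A. v - x)" for v
    by (subst A(2)) (simp add: poly_prod_mset assms(2))
  have "\<And>x. x \<in># A \<Longrightarrow> cmod x < 1"
    by (rule roots) (auto simp: poly_p)
  moreover have "A \<noteq> {#}" using A(1) assms(3) by auto
  ultimately have "cmod (\<Prod>x\<in>#A. 0 - x) < 1"
  proof (induction A)
    case (add x A)
    then have "cmod x < 1" "cmod (\<Prod>x\<in>#A. 0 - x) \<le> 1" by (cases "A = {#}"; force)+
    then have "cmod (\<Prod>x\<in>#A. 0 - x) * cmod x \<le> 1 * cmod x"
      by (intro mult_right_mono) auto
    then show ?case using \<open>cmod x < 1\<close> by (simp add: norm_mult mult.commute)
  qed simp
  then show ?thesis by (simp add: poly_p flip: poly_0_coeff_0)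
qed

section \<open>The Szego recursion and its inverse\<close>

text \<open>In terms of the usual Verblunsky coefficients \<open>\<gamma>\<^sub>n\<close>, these are the monic orthogonal polynomials
  with \<open>b\<^sub>n = - cnj \<gamma>\<^sub>n\<close>.\<close>

primrec szego :: "(nat \<Rightarrow> complex) \<Rightarrow> nat \<Rightarrow> complex poly" where
  "szego b 0 = 1"
| "szego b (Suc n) = pCons 0 (szego b n) + Polynomial.smult (b n) (conj_reflect (szego b n))"

lemma szego_cong: "(\<And>k. k < n \<Longrightarrow> b k = b' k) \<Longrightarrow> szego b n = szego b' n"
  by (induction n) auto

lemma szego_monic: "degree (szego b n) = n \<and> coeff (szego b n) n = 1"
proof (induction n)
  case (Suc n)
  have "coeff (szego b (Suc n)) (Suc n) = 1"
    using Suc by (simp add: coeff_conj_reflect)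
  moreover have "coeff (szego b (Suc n)) k = 0" if "k > Suc n" for k
    using Suc that by (cases k) (auto simp: coeff_conj_reflect coeff_eq_0)
  then have "degree (szego b (Suc n)) \<le> Suc n" by (intro degree_le) auto
  ultimately show ?case by (metis le_antisym le_degree zero_neq_one)
qed simp

lemma degree_szego [simp]: "degree (szego b n) = n"
  and lead_coeff_szego [simp]: "coeff (szego b n) n = 1"
  using szego_monic by auto

lemma conj_reflect_szego_Suc:
  "conj_reflect (szego b (Suc n)) =
    conj_reflect (szego b n) + Polynomial.smult (cnj (b n)) (pCons 0 (szego b n))"
proof -
  have "szego b n \<noteq> 0"
    by (metis lead_coeff_szego coeff_0 zero_neq_one)
  then show ?thesis
    using conj_reflect_add_smult[of "pCons 0 (szego b n)" "b n"] degree_szego[of b "Suc n"]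
    by simp
qed

text \<open>Eliminating \<open>\<Phi>\<^sub>n\<^sup>*\<close> from the recursions for \<open>\<Phi>\<^sub>n\<^sub>+\<^sub>1\<close> and \<open>\<Phi>\<^sub>n\<^sub>+\<^sub>1\<^sup>*\<close> undoes a step.\<close>

lemma inverse_szego:
  "Polynomial.smult (1 - b n * cnj (b n)) (pCons 0 (szego b n)) =
    szego b (Suc n) - Polynomial.smult (b n) (conj_reflect (szego b (Suc n)))"
  unfolding conj_reflect_szego_Suc
  by (simp add: smult_add_right smult_diff_left)

lemma coeff_0_szego_Suc: "coeff (szego b (Suc n)) 0 = b n"
  by (simp add: coeff_conj_reflect)

lemma one_minus_mult_cnj: "1 - x * cnj x = of_real (1 - (cmod x)\<^sup>2)"
  by (simp only: of_real_diff of_real_1 complex_norm_square)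

lemma one_minus_mult_cnj_nonzero: "cmod x < 1 \<Longrightarrow> 1 - x * cnj x \<noteq> 0"
  using abs_square_less_1[of "cmod x"] by (simp add: one_minus_mult_cnj del: of_real_diff)

text \<open>The last coefficient is the value of the polynomial at \<open>0\<close>, and the inverse recursion then
  recovers the previous polynomial.\<close>

lemma szego_inject:
  assumes "\<And>k. k < n \<Longrightarrow> cmod (b k) < 1" and "szego b n = szego b' n" and "k < n"
  shows "b k = b' k"
  using assms
proof (induction n)
  case (Suc n)
  have eq: "b n = b' n"
    using Suc.prems(2) coeff_0_szego_Suc by metis
  have "Polynomial.smult (1 - b n * cnj (b n)) (pCons 0 (szego b n)) =
      Polynomial.smult (1 - b n * cnj (b n)) (pCons 0 (szego b' n))"
    unfolding inverse_szego Suc.prems(2) unfolding eq inverse_szego ..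
  then have "szego b n = szego b' n"
    using one_minus_mult_cnj_nonzero[of "b n"] Suc.prems(1)
    by (metis lessI pCons_eq_iff smult_cancel)
  with Suc eq show ?case by (auto simp: less_Suc_eq)
qed simp

text \<open>One step of the Schur-Cohn algorithm replaces \<open>P\<close> by \<open>Q\<close> with
  \<open>\<gamma> x Q = P - c P\<^sup>*\<close>, where \<open>c = P(0)\<close> and \<open>\<gamma> = 1 - |c|\<^sup>2\<close>. A root \<open>w\<close> of \<open>Q\<close> with \<open>|w| \<ge> 1\<close> would satisfy
  \<open>|P(w)| = |c| |P\<^sup>*(w)| \<le> |c| |P(w)| < |P(w)|\<close>.\<close>

lemma szego_surj:
  assumes "degree p = n" "lead_coeff p = 1" and "\<And>w. poly p w = 0 \<Longrightarrow> cmod w < 1"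
  shows "\<exists>b. (\<forall>k<n. cmod (b k) < 1) \<and> szego b n = p"
  using assms
proof (induction n arbitrary: p)
  case 0
  then have "p = 1" using degree_0_id[of p] by (simp add: one_pCons)
  then show ?case by auto
next
  case (Suc n)
  define c where "c = coeff p 0"
  have c: "cmod c < 1"
    unfolding c_def using Suc.prems by (intro norm_coeff_0_less_1) auto
  define \<gamma> where "\<gamma> = 1 - c * cnj c"
  have \<gamma>: "\<gamma> \<noteq> 0" unfolding \<gamma>_def using c by (rule one_minus_mult_cnj_nonzero)
  define r where "r = p - Polynomial.smult c (conj_reflect p)"
  have "coeff r 0 = 0"
    using Suc.prems by (simp add: r_def coeff_conj_reflect c_def)
  then obtain r' where "r = pCons 0 r'" by (metis coeff_pCons_0 pCons_cases)
  then obtain q where q: "r = Polynomial.smult \<gamma> (pCons 0 q)"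
    using \<gamma> that[of "Polynomial.smult (inverse \<gamma>) r'"] by simp
  have lead_r: "coeff r (Suc n) = \<gamma>"
    using Suc.prems by (simp add: r_def coeff_conj_reflect c_def \<gamma>_def)
  have "coeff r k = 0" if "k > Suc n" for k
    using Suc.prems(1) that by (simp add: r_def coeff_conj_reflect coeff_eq_0)
  then have "degree r \<le> Suc n" by (intro degree_le) auto
  then have deg_r: "degree r = Suc n"
    using lead_r \<gamma> by (metis le_antisym le_degree)
  have q0: "q \<noteq> 0" using deg_r q by auto
  have deg_q: "degree q = n" using deg_r q q0 \<gamma> by simp
  have lead_q: "lead_coeff q = 1" using lead_r q \<gamma> deg_q by simp
  have "cmod w < 1" if "poly q w = 0" for w
  proof (rule ccontr)
    assume "\<not> cmod w < 1"
    then have w: "cmod w \<ge> 1" by simp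
    have "poly r w = 0" using that q by simp
    then have eq: "poly p w = c * poly (conj_reflect p) w" by (simp add: r_def)
    have nz: "poly p w \<noteq> 0" using Suc.prems(3)[of w] w by auto
    have "cmod (poly p w) = cmod c * cmod (poly (conj_reflect p) w)"
      by (metis eq norm_mult)
    also have "\<dots> \<le> cmod c * cmod (poly p w)"
      by (intro mult_left_mono norm_conj_reflect_le Suc.prems(3) w) auto
    also have "\<dots> < cmod (poly p w)" using c nz by simp
    finally show False by simp
  qed
  from Suc.IH[OF deg_q lead_q this]
  obtain b where b: "\<And>k. k < n \<Longrightarrow> cmod (b k) < 1" "szego b n = q" by blast
  have cong: "szego (b(n := c)) n = szego b n"
    by (rule szego_cong) simp
  \<comment> \<open>Reversal does not see the factor \<open>x\<close> of \<open>\<gamma> x Q\<close>, so the defining equation also gives \<open>Q\<^sup>*\<close>.\<close>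
  have refl: "Polynomial.smult \<gamma> (conj_reflect q) = conj_reflect p - Polynomial.smult (cnj c) p"
  proof -
    have "conj_reflect r = conj_reflect p - Polynomial.smult (cnj c) p"
      using conj_reflect_add_smult[of p "- c"] deg_r Suc.prems(1) by (simp add: r_def)
    moreover have "conj_reflect (Polynomial.smult \<gamma> (pCons 0 q)) = Polynomial.smult (cnj \<gamma>) (conj_reflect q)"
      by (simp add: conj_reflect_smult)
    moreover have "cnj \<gamma> = \<gamma>" by (simp add: \<gamma>_def mult.commute)
    ultimately show ?thesis using q by simp
  qed
  have "Polynomial.smult \<gamma> (pCons 0 q + Polynomial.smult c (conj_reflect q)) =
      r + Polynomial.smult c (Polynomial.smult \<gamma> (conj_reflect q))"
    by (simp add: q smult_add_right mult.commute)
  also have "\<dots> = Polynomial.smult \<gamma> p"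
    unfolding refl r_def by (simp add: \<gamma>_def smult_diff_left smult_diff_right)
  finally have "pCons 0 q + Polynomial.smult c (conj_reflect q) = p" using \<gamma> by (metis smult_cancel)
  then have "szego (b(n := c)) (Suc n) = p" using cong b by simp
  moreover have "\<forall>k<Suc n. cmod ((b(n := c)) k) < 1" using b c by (simp add: less_Suc_eq)
  ultimately show ?case by blast
qed


section \<open>Tridiagonal determinants\<close>

text \<open>The offset \<open>k\<close> makes the trailing blocks of such a matrix instances of the same function.\<close>

definition tridiag ::
  "(nat \<Rightarrow> 'a) \<Rightarrow> (nat \<Rightarrow> 'a) \<Rightarrow> (nat \<Rightarrow> 'a) \<Rightarrow> nat \<Rightarrow> nat \<Rightarrow> 'a :: comm_ring_1 mat" where
  "tridiag a b c k n = mat n n (\<lambda>(i, j).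
     if i = j then a (k + i) else if j = Suc i then b (k + i)
     else if i = Suc j then c (k + j) else 0)"

lemma tridiag_carrier [simp]: "tridiag a b c k n \<in> carrier_mat n n"
  by (simp add: tridiag_def)

lemma det_tridiag_0: "det (tridiag a b c k 0) = 1"
  by simp

lemma det_tridiag_1: "det (tridiag a b c k (Suc 0)) = a k"
  by (subst det_single) (auto simp: tridiag_def)

text \<open>Expansion along the first row, and of the second minor along its first column.\<close>

lemma det_tridiag_Suc_Suc:
  "det (tridiag a b c k (Suc (Suc n))) =
    a k * det (tridiag a b c (Suc k) (Suc n)) - b k * c k * det (tridiag a b c (Suc (Suc k)) n)"
proof -
  define A where "A = tridiag a b c k (Suc (Suc n))"
  define B where "B = mat_delete A 0 (Suc 0)"
  have A: "A \<in> carrier_mat (Suc (Suc n)) (Suc (Suc n))" by (simp add: A_def)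
  have B: "B \<in> carrier_mat (Suc n) (Suc n)" using mat_delete_carrier[OF A] by (simp add: B_def)
  have A00: "mat_delete A 0 0 = tridiag a b c (Suc k) (Suc n)"
    by (rule eq_matI) (auto simp: A_def tridiag_def mat_delete_def)
  have B00: "mat_delete B 0 0 = tridiag a b c (Suc (Suc k)) n"
    by (rule eq_matI) (auto simp: B_def A_def tridiag_def mat_delete_def)
  have "det B = (\<Sum>i<Suc n. B $$ (i,0) * cofactor B i 0)"
    by (rule laplace_expansion_column[OF B]) simp
  also have "\<dots> = B $$ (0,0) * cofactor B 0 0"
    by (subst sum.lessThan_Suc_shift, subst sum.neutral)
      (auto simp: B_def A_def tridiag_def mat_delete_def)
  also have "B $$ (0,0) = c k"
    by (simp add: B_def A_def tridiag_def mat_delete_def)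
  finally have det_B: "det B = c k * det (tridiag a b c (Suc (Suc k)) n)"
    by (simp add: cofactor_def B00)
  have "det A = (\<Sum>j<Suc (Suc n). A $$ (0,j) * cofactor A 0 j)"
    by (rule laplace_expansion_row[OF A]) simp
  also have "\<dots> = A $$ (0,0) * cofactor A 0 0 + A $$ (0,Suc 0) * cofactor A 0 (Suc 0)"
    by (subst sum.lessThan_Suc_shift, subst sum.lessThan_Suc_shift, subst sum.neutral)
      (auto simp: A_def tridiag_def)
  also have "\<dots> = A $$ (0,0) * det (mat_delete A 0 0) - A $$ (0,Suc 0) * det B"
    by (simp add: cofactor_def B_def)
  also have "\<dots> = a k * det (mat_delete A 0 0) - b k * det B"
    by (simp add: A_def tridiag_def)
  finally show ?thesis
    by (simp add: A00 det_B flip: A_def)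
qed

section \<open>Factorization of the truncated CMV matrix\<close>

text \<open>Entries of the block diagonal matrix with the \<open>2 \<times> 2\<close> blocks \<open>\<Theta>\<^sub>i\<close> at the rows \<open>i\<close> and \<open>i + 1\<close>, for the
  \<open>i\<close> with \<open>odd i = p\<close>. With rows starting at \<open>1\<close>, the even case begins with the lower right corner
  \<open>- \<alpha>\<^sub>0\<close> of \<open>\<Theta>\<^sub>0\<close>. The case distinction in \<open>cmv_entry\<close> by the parity of the index comes from the
  two ways in which these blocks overlap.\<close>

definition block_entry :: "bool \<Rightarrow> (nat \<Rightarrow> complex) \<Rightarrow> nat \<Rightarrow> nat \<Rightarrow> complex" where
  "block_entry p \<alpha> i j =
    (if odd i = p then (if j = i then cnj (\<alpha> i) else if j = i + 1 then cmv_rho \<alpha> i else 0)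
     else (if j = i then - \<alpha> (i - 1) else if i = j + 1 then cmv_rho \<alpha> j else 0))"

definition block_mat :: "bool \<Rightarrow> (nat \<Rightarrow> complex) \<Rightarrow> nat \<Rightarrow> complex mat" where
  "block_mat p \<alpha> N = mat N N (\<lambda>(i, j). block_entry p \<alpha> (i + 1) (j + 1))"

lemma block_mat_carrier [simp]: "block_mat p \<alpha> N \<in> carrier_mat N N"
  by (simp add: block_mat_def)

text \<open>A row of the left factor meets one block, hence at most two entries of the right factor.
  The assumption \<open>\<rho>\<^sub>N = 0\<close> says that the block \<open>\<Theta>\<^sub>N\<close>, of which only the corner \<open>cnj \<alpha>\<^sub>N\<close> fits into the
  matrix, is diagonal; so the term with row index \<open>N + 1\<close> vanishes.\<close>

lemma block_mat_mult_entry: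
  assumes "i < N" "j < N" "B = mat N N (\<lambda>(i, j). g (i + 1) (j + 1))" and "cmv_rho \<alpha> N = 0"
  shows "(block_mat p \<alpha> N * B) $$ (i, j) =
    (if odd (i + 1) = p
     then cnj (\<alpha> (i + 1)) * g (i + 1) (j + 1) + cmv_rho \<alpha> (i + 1) * g (i + 2) (j + 1)
     else - \<alpha> i * g (i + 1) (j + 1) + (if i = 0 then 0 else cmv_rho \<alpha> i * g i (j + 1)))"
proof -
  have "(block_mat p \<alpha> N * B) $$ (i, j) =
      (\<Sum>k\<in>{0..<N}. block_entry p \<alpha> (i + 1) (k + 1) * g (k + 1) (j + 1))"
    using assms(1-3) by (simp add: block_mat_def scalar_prod_def)
  also have "\<dots> = (\<Sum>k\<in>{0..<N}.
     (if k = i then (if odd (i + 1) = p then cnj (\<alpha> (i + 1)) else - \<alpha> i) * g (i + 1) (j + 1) else 0)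
     + (if k = i + 1 then if odd (i + 1) = p then cmv_rho \<alpha> (i + 1) * g (i + 2) (j + 1) else 0 else 0)
     + (if k = i - 1 then if odd (i + 1) = p \<or> i = 0 then 0 else cmv_rho \<alpha> i * g i (j + 1) else 0))"
    by (rule sum.cong) (auto simp: block_entry_def)
  also have "\<dots> = (if odd (i + 1) = p
     then cnj (\<alpha> (i + 1)) * g (i + 1) (j + 1) + cmv_rho \<alpha> (i + 1) * g (i + 2) (j + 1)
     else - \<alpha> i * g (i + 1) (j + 1) + (if i = 0 then 0 else cmv_rho \<alpha> i * g i (j + 1)))"
  proof -
    have "cmv_rho \<alpha> (Suc i) = 0" if "\<not> Suc i < N"
      using that assms(1,4) by (metis Suc_lessI)
    then show ?thesis
      using assms(1) by (cases "Suc i < N"; cases i) (simp_all add: sum.distrib)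
  qed
  finally show ?thesis .
qed

lemma cmv_rho_sq: "cmod (\<alpha> n) \<le> 1 \<Longrightarrow> cmv_rho \<alpha> n * cmv_rho \<alpha> n = 1 - \<alpha> n * cnj (\<alpha> n)"
  unfolding one_minus_mult_cnj cmv_rho_def of_real_mult[symmetric]
  by (simp add: abs_square_le_1)

lemma cmv_rho_cnj [simp]: "cmv_rho (\<lambda>n. cnj (\<alpha> n)) = cmv_rho \<alpha>"
  by (simp add: cmv_rho_def fun_eq_iff)

lemma block_mat_factorization:
  assumes "cmv_rho \<alpha> N = 0"
  shows "block_mat False \<alpha> N * block_mat True \<alpha> N = truncated_cmv N \<alpha>"
proof (rule eq_matI)
  fix i j assume "i < dim_row (truncated_cmv N \<alpha>)" "j < dim_col (truncated_cmv N \<alpha>)"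
  then have ij: "i < N" "j < N" by (auto simp: truncated_cmv_def)
  show "(block_mat False \<alpha> N * block_mat True \<alpha> N) $$ (i, j) = truncated_cmv N \<alpha> $$ (i, j)"
  proof -
    note entry = block_mat_mult_entry[OF ij block_mat_def assms]
    consider "j = i" | "j = Suc i" | "i = Suc j" | "j = Suc (Suc i)" | "i = Suc (Suc j)"
      | "i > Suc (Suc j)" | "j > Suc (Suc i)"
      by linarith
    then show ?thesis
      unfolding entry using ij
      by cases (simp_all add: truncated_cmv_def block_entry_def cmv_entry_def)
  qed
qed (auto simp: truncated_cmv_def block_mat_def)

text \<open>The blocks \<open>\<Theta>\<^sub>k\<close> are symmetric and unitary, so conjugating the parameters inverts them.\<close>

lemma block_mat_inverse:
  assumes "cmv_rho \<alpha> N = 0" "\<And>n. n \<le> N \<Longrightarrow> cmod (\<alpha> n) \<le> 1"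
  shows "block_mat True (\<lambda>n. cnj (\<alpha> n)) N * block_mat True \<alpha> N = 1\<^sub>m N"
proof (rule eq_matI)
  fix i j assume "i < dim_row (1\<^sub>m N)" "j < dim_col (1\<^sub>m N)"
  then have ij: "i < N" "j < N" by auto
  have sq: "cmv_rho \<alpha> n * cmv_rho \<alpha> n = 1 - \<alpha> n * cnj (\<alpha> n)" if "n \<le> N" for n
    by (rule cmv_rho_sq) (use that assms(2) in auto)
  show "(block_mat True (\<lambda>n. cnj (\<alpha> n)) N * block_mat True \<alpha> N) $$ (i, j) = 1\<^sub>m N $$ (i, j)"
  proof -
    have "cmv_rho (\<lambda>n. cnj (\<alpha> n)) N = 0" using assms(1) by simp
    note entry = block_mat_mult_entry[OF ij block_mat_def this]
    consider "j = i" | "j = Suc i" | "i = Suc j" | "i > Suc j" | "j > Suc i"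
      by linarith
    then show ?thesis
      unfolding entry using ij by cases (simp_all add: block_entry_def sq)
  qed
qed (auto simp: block_mat_def)

text \<open>Diagonal and off-diagonal entries of \<open>x M\<^sup>* - L\<close>.\<close>

definition pencil_diag :: "(nat \<Rightarrow> complex) \<Rightarrow> complex \<Rightarrow> nat \<Rightarrow> complex" where
  "pencil_diag \<alpha> x i =
    (if odd i then x * \<alpha> i + \<alpha> (i - 1) else - (x * cnj (\<alpha> (i - 1)) + cnj (\<alpha> i)))"

definition pencil_off :: "(nat \<Rightarrow> complex) \<Rightarrow> complex \<Rightarrow> nat \<Rightarrow> complex" where
  "pencil_off \<alpha> x i = (if odd i then x * cmv_rho \<alpha> i else - cmv_rho \<alpha> i)"

abbreviation pencil :: "(nat \<Rightarrow> complex) \<Rightarrow> complex \<Rightarrow> nat \<Rightarrow> nat \<Rightarrow> complex mat" where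
  "pencil \<alpha> x \<equiv> tridiag (pencil_diag \<alpha> x) (pencil_off \<alpha> x) (pencil_off \<alpha> x)"

lemma pencil_eq:
  "pencil \<alpha> x 1 N = x \<cdot>\<^sub>m block_mat True (\<lambda>n. cnj (\<alpha> n)) N + (- 1) \<cdot>\<^sub>m block_mat False \<alpha> N"
  by (rule eq_matI)
    (auto simp: tridiag_def block_mat_def block_entry_def pencil_diag_def pencil_off_def)

text \<open>Take determinants in \<open>x - T = (x M\<^sup>* - L) M\<close>. That \<open>det M\<close> is a nonzero constant suffices, as
  the characteristic polynomial is monic.\<close>

lemma poly_char_poly_truncated_cmv:
  assumes "cmv_parameters N \<alpha>"
  shows "poly (char_poly (truncated_cmv N \<alpha>)) x = det (pencil \<alpha> x 1 N) * det (block_mat True \<alpha> N)"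
    and "det (block_mat True \<alpha> N) \<noteq> 0"
proof -
  let ?M = "block_mat True \<alpha> N" and ?K = "block_mat True (\<lambda>n. cnj (\<alpha> n)) N"
    and ?L = "block_mat False \<alpha> N"
  have rho: "cmv_rho \<alpha> N = 0" using assms by (simp add: cmv_parameters_def cmv_rho_def)
  have le: "cmod (\<alpha> n) \<le> 1" if "n \<le> N" for n
    using assms that by (cases "n = N") (auto simp: cmv_parameters_def less_imp_le)
  have inv: "?K * ?M = 1\<^sub>m N" by (rule block_mat_inverse) (use rho le in auto)
  have "det ?K * det ?M = det (?K * ?M)" by (rule det_mult[of _ N, symmetric]) auto
  then have "det ?K * det ?M = 1" by (simp only: inv det_one)
  then show "det ?M \<noteq> 0" by auto
  have T: "truncated_cmv N \<alpha> \<in> carrier_mat N N" by (simp add: truncated_cmv_def)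
  have "pencil \<alpha> x 1 N * ?M = (x \<cdot>\<^sub>m ?K) * ?M + ((- 1) \<cdot>\<^sub>m ?L) * ?M"
    unfolding pencil_eq by (rule add_mult_distrib_mat[where nr = N and n = N and nc = N]) auto
  also have "\<dots> = x \<cdot>\<^sub>m (?K * ?M) + (- 1) \<cdot>\<^sub>m (?L * ?M)"
    by (subst (1 2) mult_smult_assoc_mat[where nr = N and n = N and nc = N]) auto
  also have "\<dots> = - char_matrix (truncated_cmv N \<alpha>) x"
    unfolding inv block_mat_factorization[OF rho]
    by (rule eq_matI) (auto simp: char_matrix_def truncated_cmv_def)
  finally have "det (- char_matrix (truncated_cmv N \<alpha>) x) = det (pencil \<alpha> x 1 N * ?M)" by simp
  then show "poly (char_poly (truncated_cmv N \<alpha>)) x = det (pencil \<alpha> x 1 N) * det ?M"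
    by (simp add: char_poly_matrix[OF T] det_mult[of _ N])
qed

section \<open>The characteristic polynomial\<close>

text \<open>These are the coefficients \<open>b\<^sub>n\<close> with \<open>n < N\<close>. The factor \<open>cnj \<alpha>\<^sub>N\<close> makes them invariant under
  multiplication of all parameters by a unimodular number.\<close>

definition reversed_parameters :: "nat \<Rightarrow> (nat \<Rightarrow> complex) \<Rightarrow> nat \<Rightarrow> complex" where
  "reversed_parameters N \<alpha> n = \<alpha> (N - 1 - n) * cnj (\<alpha> N)"

text \<open>Write \<open>i = N - n\<close> and \<open>D\<^sub>i\<close> for the trailing minor that starts at row \<open>i\<close>. Up to a constant, \<open>D\<^sub>i\<close> is
  \<open>\<Phi>\<^sub>n\<^sub>+\<^sub>1\<close> for odd \<open>i\<close> and \<open>\<Phi>\<^sub>n\<^sub>+\<^sub>1\<^sup>*\<close> for even \<open>i\<close>. The three-term recursion involves two consecutive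
  minors, so the induction also carries \<open>D\<^sub>i\<^sub>+\<^sub>1\<close>, with its constant relative to that of \<open>D\<^sub>i\<close>.
  The constant \<open>s\<close> does not depend on \<open>x\<close>.\<close>

lemma det_pencil:
  assumes "cmv_parameters N \<alpha>" and "n < N"
  shows "\<exists>s. s \<noteq> 0 \<and> (\<forall>x.
    if odd (N - n)
    then det (pencil \<alpha> x (N - n) (Suc n)) = s * poly (szego (reversed_parameters N \<alpha>) (Suc n)) x
       \<and> det (pencil \<alpha> x (Suc (N - n)) n) =
           s * cnj (\<alpha> N) * poly (conj_reflect (szego (reversed_parameters N \<alpha>) n)) x
    else det (pencil \<alpha> x (N - n) (Suc n)) =
           - s * cnj (\<alpha> N) * poly (conj_reflect (szego (reversed_parameters N \<alpha>) (Suc n))) x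
       \<and> det (pencil \<alpha> x (Suc (N - n)) n) = s * poly (szego (reversed_parameters N \<alpha>) n) x)"
  using assms(2)
proof (induction n)
  case 0
  \<comment> \<open>\<open>cnj\<close> is hidden in fresh names, so that the identities become polynomial ones modulo \<open>A A' = 1\<close>.\<close>
  define A A' a where "A = \<alpha> N" and "A' = cnj (\<alpha> N)" and "a = \<alpha> (N - 1)"
  have AA': "A * A' = 1"
    using assms(1) by (simp add: A_def A'_def cmv_parameters_def complex_norm_square[symmetric])
  have red: "reversed_parameters N \<alpha> 0 = a * A'" by (simp add: reversed_parameters_def a_def A'_def)
  have one: "conj_reflect 1 = 1" by (simp add: conj_reflect_def)
  have P1: "poly (szego (reversed_parameters N \<alpha>) (Suc 0)) x = x + a * A'" for x
    by (simp add: red one)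
  have Q1: "poly (conj_reflect (szego (reversed_parameters N \<alpha>) (Suc 0))) x = 1 + cnj a * A * x" for x
    unfolding conj_reflect_szego_Suc red by (simp add: one A_def A'_def)
  have odd: "x * A + a = A * (x + a * A')" for x using AA' by Groebner_Basis.algebra
  have even: "- (x * cnj a + A') = - 1 * A' * (1 + cnj a * A * x)" for x using AA' by Groebner_Basis.algebra
  have "A \<noteq> 0" using AA' by auto
  show ?case
  proof (cases "odd N")
    case True
    then have "pencil_diag \<alpha> x N = A * (x + a * A')" for x
      unfolding odd[symmetric] by (simp add: pencil_diag_def A_def a_def)
    then show ?thesis
      unfolding P1 diff_zero det_tridiag_1 det_tridiag_0 szego.simps(1) one poly_1
        A'_def[symmetric]
      using True \<open>A \<noteq> 0\<close> AA' by (intro exI[of _ A]) simp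
  next
    case False
    then have "pencil_diag \<alpha> x N = - 1 * A' * (1 + cnj a * A * x)" for x
      unfolding even[symmetric] by (simp add: pencil_diag_def A'_def a_def)
    then show ?thesis
      unfolding Q1 diff_zero det_tridiag_1 det_tridiag_0 szego.simps(1) one poly_1
        A'_def[symmetric]
      using False by (intro exI[of _ 1]) simp
  qed
next
  case (Suc n)
  define i where "i = N - Suc n"
  have i: "N - n = Suc i" "N - 1 - n = i" "N - 1 - Suc n = i - 1" "N - Suc n = i" "i < N"
    using Suc.prems by (auto simp: i_def)
  define A A' where "A = \<alpha> N" and "A' = cnj (\<alpha> N)"
  have AA': "A * A' = 1"
    using assms(1) by (simp add: A_def A'_def cmv_parameters_def complex_norm_square[symmetric])
  define a a' where "a = \<alpha> i" and "a' = cnj (\<alpha> i)"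
  define p p' where "p = \<alpha> (i - 1)" and "p' = cnj (\<alpha> (i - 1))"
  have rho: "cmv_rho \<alpha> i * cmv_rho \<alpha> i = 1 - a * a'"
    unfolding a_def a'_def
    by (rule cmv_rho_sq) (use assms(1) i in \<open>auto simp: cmv_parameters_def less_imp_le\<close>)
  have red: "reversed_parameters N \<alpha> n = a * A'" "cnj (reversed_parameters N \<alpha> n) = a' * A"
    "reversed_parameters N \<alpha> (Suc n) = p * A'" "cnj (reversed_parameters N \<alpha> (Suc n)) = p' * A"
    by (simp_all only: reversed_parameters_def i A_def A'_def a_def a'_def p_def p'_def
        complex_cnj_mult complex_cnj_cnj)
  define P Q P1 Q1 where "P = poly (szego (reversed_parameters N \<alpha>) n)"
    and "Q = poly (conj_reflect (szego (reversed_parameters N \<alpha>) n))"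
    and "P1 = poly (szego (reversed_parameters N \<alpha>) (Suc n))"
    and "Q1 = poly (conj_reflect (szego (reversed_parameters N \<alpha>) (Suc n)))"
  have P1: "P1 x = x * P x + a * A' * Q x" and Q1: "Q1 x = Q x + a' * A * (x * P x)" for x
    unfolding P1_def Q1_def P_def Q_def conj_reflect_szego_Suc red(2,4)
    by (simp_all add: red(1))
  have P2: "poly (szego (reversed_parameters N \<alpha>) (Suc (Suc n))) x = x * P1 x + p * A' * Q1 x" for x
    unfolding P1_def Q1_def szego.simps(2)[of _ "Suc n"] red(3) by (simp del: szego.simps)
  have Q2: "poly (conj_reflect (szego (reversed_parameters N \<alpha>) (Suc (Suc n)))) x =
      Q1 x + p' * A * (x * P1 x)" for x
    unfolding P1_def Q1_def conj_reflect_szego_Suc[of _ "Suc n"] red(4) by (simp del: szego.simps)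
  define D where "D x = det (pencil \<alpha> x i (Suc (Suc n)))" for x
  define D1 where "D1 x = det (pencil \<alpha> x (Suc i) (Suc n))" for x
  define D2 where "D2 x = det (pencil \<alpha> x (Suc (Suc i)) n)" for x
  have D: "D x = pencil_diag \<alpha> x i * D1 x - pencil_off \<alpha> x i * pencil_off \<alpha> x i * D2 x" for x
    unfolding D_def D1_def D2_def by (rule det_tridiag_Suc_Suc)
  obtain s where s: "s \<noteq> 0" and IH: "\<And>x. if odd (Suc i) then D1 x = s * P1 x \<and> D2 x = s * A' * Q x
      else D1 x = - s * A' * Q1 x \<and> D2 x = s * P x"
    using Suc.IH Suc.prems unfolding i D1_def D2_def P_def Q_def P1_def Q1_def A'_def by auto
  show ?case
  proof (cases "odd i")
    case True
    have D1: "D1 x = - s * A' * Q1 x" and D2: "D2 x = s * P x" for x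
      using IH[of x] True by auto
    \<comment> \<open>This holds because \<open>\<Phi>\<^sub>n\<^sub>+\<^sub>1 = b\<^sub>n \<Phi>\<^sub>n\<^sub>+\<^sub>1\<^sup>* + (1 - |b\<^sub>n|\<^sup>2) x \<Phi>\<^sub>n\<close>; here the constant changes sign.\<close>
    have "D x = - s * (x * P1 x + p * A' * Q1 x)" for x
    proof -
      have "D x = (x * a + p) * D1 x - x * x * (cmv_rho \<alpha> i * cmv_rho \<alpha> i) * D2 x"
        using True unfolding D by (simp add: pencil_diag_def pencil_off_def a_def p_def mult_ac)
      then show ?thesis unfolding rho D1 D2 P1 Q1 using AA' by Groebner_Basis.algebra
    qed
    then show ?thesis
      unfolding i P2 Q2 using True s D1
      by (intro exI[of _ "- s"]) (simp add: D_def D1_def Q1_def A'_def)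
  next
    case False
    have D1: "D1 x = s * P1 x" and D2: "D2 x = s * A' * Q x" for x
      using IH[of x] False by auto
    \<comment> \<open>This holds because \<open>\<Phi>\<^sub>n\<^sub>+\<^sub>1\<^sup>* = cnj b\<^sub>n \<Phi>\<^sub>n\<^sub>+\<^sub>1 + (1 - |b\<^sub>n|\<^sup>2) \<Phi>\<^sub>n\<^sup>*\<close>.\<close>
    have "D x = - s * A' * (Q1 x + p' * A * (x * P1 x))" for x
    proof -
      have "D x = - (x * p' + a') * D1 x - (cmv_rho \<alpha> i * cmv_rho \<alpha> i) * D2 x"
        using False unfolding D by (simp add: pencil_diag_def pencil_off_def a'_def p'_def mult_ac)
      then show ?thesis unfolding rho D1 D2 P1 Q1 using AA' by Groebner_Basis.algebra
    qed
    then show ?thesis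
      unfolding i P2 Q2 using False s D1
      by (intro exI[of _ s]) (simp add: D_def D1_def P1_def A'_def)
  qed
qed

lemma char_poly_truncated_cmv:
  assumes "cmv_parameters N \<alpha>" and "N \<ge> 1"
  shows "char_poly (truncated_cmv N \<alpha>) = szego (reversed_parameters N \<alpha>) N"
proof -
  have N: "N - (N - 1) = 1" "Suc (N - 1) = N" using assms(2) by auto
  obtain s where s: "s \<noteq> 0" "\<And>x. det (pencil \<alpha> x 1 N) = s * poly (szego (reversed_parameters N \<alpha>) N) x"
    using det_pencil[OF assms(1), of "N - 1"] assms(2) unfolding N by auto
  define c where "c = s * det (block_mat True \<alpha> N)"
  have "char_poly (truncated_cmv N \<alpha>) = Polynomial.smult c (szego (reversed_parameters N \<alpha>) N)"
    by (rule poly_ext) (simp add: poly_char_poly_truncated_cmv(1)[OF assms(1)] s(2) c_def mult_ac del: One_nat_def)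
  moreover from this have "c = 1"
    using degree_monic_char_poly[of "truncated_cmv N \<alpha>" N] lead_coeff_szego[of "reversed_parameters N \<alpha>" N]
    by (simp add: truncated_cmv_def)
  ultimately show ?thesis by simp
qed

section \<open>Prescribing the eigenvalues\<close>

lemma proots_prod_linear: "proots (\<Prod>x\<in>#A. [:- x, 1:]) = (A :: complex multiset)"
proof (induction A)
  case (add x A)
  have "(\<Prod>x\<in>#A. [:- x, 1:]) \<noteq> (0 :: complex poly)" by auto
  then have "proots ([:- x, 1:] * (\<Prod>x\<in>#A. [:- x, 1:])) = {#x#} + A"
    by (subst proots_mult) (auto simp: add.IH)
  then show ?case by simp
qed simp

lemma proots_eq_iff_monic:
  fixes p :: "complex poly"
  assumes "lead_coeff p = 1" and "finite I"
  shows "proots p = image_mset z (mset_set I) \<longleftrightarrow> p = (\<Prod>i\<in>I. [:- z i, 1:])"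
proof
  have *: "(\<Prod>x\<in>#image_mset z (mset_set I). [:- x, 1:]) = (\<Prod>i\<in>I. [:- z i, 1:])"
    by (simp add: prod_unfold_prod_mset multiset.map_comp comp_def)
  assume "proots p = image_mset z (mset_set I)"
  moreover have "p = (\<Prod>x\<in>#proots p. [:- x, 1:])"
  proof -
    have "p \<noteq> 0" using assms by auto
    then obtain A where A: "p = Polynomial.smult (lead_coeff p) (\<Prod>x\<in>#A. [:-x, 1:])"
      using alg_closed_imp_factorization by blast
    then have p: "p = (\<Prod>x\<in>#A. [:-x, 1:])" by (simp add: assms)
    moreover have "proots p = A"
      unfolding p by (rule proots_prod_linear)
    ultimately show ?thesis by simp
  qed
  ultimately show "p = (\<Prod>i\<in>I. [:- z i, 1:])" using * by simp
next
  assume p: "p = (\<Prod>i\<in>I. [:- z i, 1:])"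
  show "proots p = image_mset z (mset_set I)"
    unfolding p by (subst proots_prod) (auto simp: assms sum_unfold_sum_mset)
qed

theorem theorem7p1:
  fixes N :: nat and z :: "nat \<Rightarrow> complex"
  assumes "N \<ge> 1"
    and "\<And>i. i \<in> {1..N} \<Longrightarrow> cmod (z i) < 1"
  shows "(\<exists>\<alpha>. cmv_parameters N \<alpha> \<and>
            eigenvalue_mset (truncated_cmv N \<alpha>) = image_mset z (mset_set {1..N})) \<and>
         (\<forall>\<alpha> \<beta>. cmv_parameters N \<alpha> \<and> cmv_parameters N \<beta> \<and>
            eigenvalue_mset (truncated_cmv N \<alpha>) = image_mset z (mset_set {1..N}) \<longrightarrow>
            (eigenvalue_mset (truncated_cmv N \<beta>) = image_mset z (mset_set {1..N}) \<longleftrightarrow>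
             (\<exists>c. cmod c = 1 \<and> (\<forall>n\<le>N. \<beta> n = c * \<alpha> n))))"
proof -
  define q where "q = (\<Prod>i\<in>{1..N}. [:- z i, 1:])"
  have spec: "eigenvalue_mset (truncated_cmv N \<alpha>) = image_mset z (mset_set {1..N}) \<longleftrightarrow>
      szego (reversed_parameters N \<alpha>) N = q" if "cmv_parameters N \<alpha>" for \<alpha>
    unfolding eigenvalue_mset_def char_poly_truncated_cmv[OF that assms(1)] q_def
    by (rule proots_eq_iff_monic) auto
  have red_less: "cmod (reversed_parameters N \<alpha> k) < 1" if "cmv_parameters N \<alpha>" "k < N" for \<alpha> k
    using that by (auto simp: reversed_parameters_def cmv_parameters_def norm_mult)
  have "degree q = N"
    by (simp add: q_def degree_prod_eq_sum_degree)
  moreover have "lead_coeff q = 1"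
    unfolding q_def lead_coeff_prod by simp
  moreover have "cmod w < 1" if "poly q w = 0" for w
    using that assms(2) by (auto simp: q_def poly_prod)
  ultimately obtain b where b: "\<And>k. k < N \<Longrightarrow> cmod (b k) < 1" "szego b N = q"
    using szego_surj by blast
  \<comment> \<open>The common unimodular factor is free, so the last parameter may be taken to be \<open>1\<close>.\<close>
  define \<alpha>0 where "\<alpha>0 n = (if n < N then b (N - 1 - n) else 1)" for n
  have \<alpha>0: "cmv_parameters N \<alpha>0"
    using b(1) by (auto simp: cmv_parameters_def \<alpha>0_def)
  have "szego (reversed_parameters N \<alpha>0) N = szego b N"
    by (rule szego_cong) (auto simp: reversed_parameters_def \<alpha>0_def)
  then have existence: "eigenvalue_mset (truncated_cmv N \<alpha>0) = image_mset z (mset_set {1..N})"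
    using spec[OF \<alpha>0] b(2) by simp
  have uniqueness: "szego (reversed_parameters N \<beta>) N = q \<longleftrightarrow> (\<exists>c. cmod c = 1 \<and> (\<forall>n\<le>N. \<beta> n = c * \<alpha> n))"
    if \<alpha>: "cmv_parameters N \<alpha>" and \<beta>: "cmv_parameters N \<beta>" and q: "szego (reversed_parameters N \<alpha>) N = q"
    for \<alpha> \<beta>
  proof
    have unit: "\<gamma> N * cnj (\<gamma> N) = 1" "cmod (\<gamma> N) = 1" if "cmv_parameters N \<gamma>" for \<gamma>
      using that by (simp_all add: cmv_parameters_def complex_norm_square[symmetric])
    assume "szego (reversed_parameters N \<beta>) N = q"
    then have eq: "reversed_parameters N \<alpha> k = reversed_parameters N \<beta> k" if "k < N" for k
      using szego_inject[of N "reversed_parameters N \<alpha>"] red_less[OF \<alpha>] q that by auto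
    have "\<beta> n = \<beta> N * cnj (\<alpha> N) * \<alpha> n" if "n \<le> N" for n
    proof (cases "n = N")
      case True
      with unit(1)[OF \<alpha>] show ?thesis by (simp add: mult_ac)
    next
      case False
      with that eq[of "N - 1 - n"] have "\<alpha> n * cnj (\<alpha> N) = \<beta> n * cnj (\<beta> N)"
        by (simp add: reversed_parameters_def)
      with unit(1)[OF \<beta>] show ?thesis by Groebner_Basis.algebra
    qed
    moreover have "cmod (\<beta> N * cnj (\<alpha> N)) = 1"
      using unit(2)[OF \<alpha>] unit(2)[OF \<beta>] by (simp add: norm_mult)
    ultimately show "\<exists>c. cmod c = 1 \<and> (\<forall>n\<le>N. \<beta> n = c * \<alpha> n)" by blast
  next
    assume "\<exists>c. cmod c = 1 \<and> (\<forall>n\<le>N. \<beta> n = c * \<alpha> n)"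
    then obtain c where c: "cmod c = 1" "\<And>n. n \<le> N \<Longrightarrow> \<beta> n = c * \<alpha> n" by blast
    have "c * cnj c = 1" using c(1) by (simp add: complex_norm_square[symmetric])
    then have "reversed_parameters N \<beta> k = reversed_parameters N \<alpha> k" for k
      unfolding reversed_parameters_def using c(2)[of "N - 1 - k"] c(2)[of N] by simp
    then have "reversed_parameters N \<beta> = reversed_parameters N \<alpha>" by (rule ext)
    then show "szego (reversed_parameters N \<beta>) N = q" using q by simp
  qed
  show ?thesis
  proof (intro conjI allI impI)
    show "\<exists>\<alpha>. cmv_parameters N \<alpha> \<and>
        eigenvalue_mset (truncated_cmv N \<alpha>) = image_mset z (mset_set {1..N})"
      using \<alpha>0 existence by blast
  next
    fix \<alpha> \<beta>
    assume "cmv_parameters N \<alpha> \<and> cmv_parameters N \<beta> \<and>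
      eigenvalue_mset (truncated_cmv N \<alpha>) = image_mset z (mset_set {1..N})"
    then have \<alpha>: "cmv_parameters N \<alpha>" and \<beta>: "cmv_parameters N \<beta>"
      and eig: "eigenvalue_mset (truncated_cmv N \<alpha>) = image_mset z (mset_set {1..N})"
      by blast+
    show "eigenvalue_mset (truncated_cmv N \<beta>) = image_mset z (mset_set {1..N}) \<longleftrightarrow>
        (\<exists>c. cmod c = 1 \<and> (\<forall>n\<le>N. \<beta> n = c * \<alpha> n))"
      unfolding spec[OF \<beta>] by (rule uniqueness[OF \<alpha> \<beta> iffD1[OF spec[OF \<alpha>] eig]])
  qed
qed

end
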